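(* Let $\Psi=(S,C,F)$ be an expansion system and let $y\in S_0$ be such that $\Psi$ is proper at every order $m\in\mathbb N$ with respect to $y$. Then the sequence $\hat P(y^{[m]})$ converges, as $m\to\infty$, to $\hat P(y)$ in the discrete product topology $\mathscr D^*$ on $\hat C$. Furthermore, $y^{[m]}$ converges to $y$ in the weakly discrete topology $\hat P^{-1}(\mathscr D^* )$ on $S_0$.
   Context: $\mathbb N=\{0,1,2,\dots\}$. An expansion system $\Psi=(S,C,F)$ consists of sets $S_i$ ($i\in\mathbb N$), each with a distinguished neutral element $\nu_i\in S_i$, sets $C_i$ ($i\in\mathbb N$), and maps $P_i\colon S_i\to C_i$ and $E_i\colon S_i\to S_{i+1}$ such that $E_i(\nu_i)=\nu_{i+1}$ and $F_i=(P_i,E_i)\colon S_i\to C_i\times S_{i+1}$ is injective, for all $i$. For $y\in S_0$ put $y_0=y$, $y_{i+1}=E_i(y_i)$, $\hat P_i(y)=c_i=P_i(y_i)$. Put $\hat C=\prod_{i\in\mathbb N}C_i$ and $\hat P\colon S_0\to\hat C$, $\hat P(y)=(c_0,c_1,\dots)$. Properness and convergents: given $y\in S_0$ with coefficients $c_i$ and $n\in\mathbb N$, set $y^{[n]}_n=\nu_n$ and, for $i=n-1,\dots,0$, $y^{[n]}_i=F_i^{-1}(c_i,y^{[n]}_{i+1})$, provided $(c_i,y^{[n]}_{i+1})\in F_i(S_i)$. If this proviso holds at every step, $\Psi$ is called proper at order $n$ with respect to $y$, and $y^{[n]}:=y^{[n]}_0$ is the $n$-th convergent of $y$. Topologies: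 $\mathscr D^*$ is the product topology on $\hat C$ when every $C_i$ is discrete. The weakly discrete topology $\hat P^{-1}(\mathscr D^* )$ on $S_0$ is the topology generated by the sets $\hat P^{-1}(U)$ with $U$ open in $\mathscr D^*$. *)

theory Defs
  imports "HOL-Analysis.Analysis"
begin

text \<open>The families \<open>S\<^sub>i\<close> and \<open>C\<^sub>i\<close> are arbitrary sets in two carrier types, so they may differ
  from index to index. The maps \<open>P\<^sub>i\<close> and \<open>E\<^sub>i\<close> are only relevant on \<open>S\<^sub>i\<close>.\<close>

record ('s, 'c) expansion_data =
  state_set :: "nat \<Rightarrow> 's set"
  coeff_set :: "nat \<Rightarrow> 'c set"
  neutral :: "nat \<Rightarrow> 's"
  pmap :: "nat \<Rightarrow> 's \<Rightarrow> 'c"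
  emap :: "nat \<Rightarrow> 's \<Rightarrow> 's"

definition fmap_at :: "('s, 'c) expansion_data \<Rightarrow> nat \<Rightarrow> 's \<Rightarrow> 'c \<times> 's" where
  "fmap_at \<Psi> i x = (pmap \<Psi> i x, emap \<Psi> i x)"

definition expansion_system :: "('s, 'c) expansion_data \<Rightarrow> bool" where
  "expansion_system \<Psi> \<longleftrightarrow>
     (\<forall>i. neutral \<Psi> i \<in> state_set \<Psi> i \<and>
          pmap \<Psi> i \<in> state_set \<Psi> i \<rightarrow> coeff_set \<Psi> i \<and>
          emap \<Psi> i \<in> state_set \<Psi> i \<rightarrow> state_set \<Psi> (Suc i) \<and>
          emap \<Psi> i (neutral \<Psi> i) = neutral \<Psi> (Suc i) \<and>
          inj_on (fmap_at \<Psi> i) (state_set \<Psi> i))"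

primrec tail :: "('s, 'c) expansion_data \<Rightarrow> 's \<Rightarrow> nat \<Rightarrow> 's" where
  "tail \<Psi> y 0 = y"
| "tail \<Psi> y (Suc i) = emap \<Psi> i (tail \<Psi> y i)"

definition P_hat :: "('s, 'c) expansion_data \<Rightarrow> 's \<Rightarrow> nat \<Rightarrow> 'c" where
  "P_hat \<Psi> y = (\<lambda>i. pmap \<Psi> i (tail \<Psi> y i))"

text \<open>\<open>conv_tail \<Psi> y n i\<close> is \<open>y\<^sup>[\<^sup>n\<^sup>]\<^sub>i\<close> for \<open>i \<le> n\<close>. Being a total function it returns an arbitrary
  value at and below an index where the pair is not in \<open>F\<^sub>i(S\<^sub>i)\<close>; \<open>proper_at\<close> says that this
  never happens.\<close>

function conv_tail :: "('s, 'c) expansion_data \<Rightarrow> 's \<Rightarrow> nat \<Rightarrow> nat \<Rightarrow> 's" where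
  "conv_tail \<Psi> y n i =
     (if i < n
      then inv_into (state_set \<Psi> i) (fmap_at \<Psi> i) (P_hat \<Psi> y i, conv_tail \<Psi> y n (Suc i))
      else neutral \<Psi> n)"
  by pat_completeness auto
termination
  by (relation "Wellfounded.measure (\<lambda>(\<Psi>, y, n, i). n - i)") auto

declare conv_tail.simps [simp del]

definition proper_at :: "('s, 'c) expansion_data \<Rightarrow> 's \<Rightarrow> nat \<Rightarrow> bool" where
  "proper_at \<Psi> y n \<longleftrightarrow>
     (\<forall>i<n. (P_hat \<Psi> y i, conv_tail \<Psi> y n (Suc i)) \<in> fmap_at \<Psi> i ` state_set \<Psi> i)"

definition conv :: "('s, 'c) expansion_data \<Rightarrow> 's \<Rightarrow> nat \<Rightarrow> 's" where
  "conv \<Psi> y n = conv_tail \<Psi> y n 0"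

definition discrete_product :: "('s, 'c) expansion_data \<Rightarrow> (nat \<Rightarrow> 'c) topology" where
  "discrete_product \<Psi> = product_topology (\<lambda>i. discrete_topology (coeff_set \<Psi> i)) UNIV"

definition weakly_discrete :: "('s, 'c) expansion_data \<Rightarrow> 's topology" where
  "weakly_discrete \<Psi> =
     topology_generated_by {P_hat \<Psi> -` U \<inter> state_set \<Psi> 0 |U. openin (discrete_product \<Psi>) U}"

end

theory Submission
  imports Defs
begin

text \<open>Every tail of the convergent of order \<open>m\<close> up to index \<open>m\<close> is the corresponding term of the
  backward recursion, so the convergent and \<open>y\<close> share their first \<open>m\<close> coefficients. Each
  coefficient is therefore eventually constant along the convergents.\<close>

text \<open>Eventual membership survives finite intersections and arbitrary unions, so it need only
  be tested on generators. A point in no generator would pass that test vacuously, hence the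
  separate condition on \<open>l\<close>.\<close>

lemma limitin_topology_generated_by:
  "limitin (topology_generated_by \<B>) f l F \<longleftrightarrow>
     l \<in> \<Union>\<B> \<and> (\<forall>B\<in>\<B>. l \<in> B \<longrightarrow> (\<forall>\<^sub>F x in F. f x \<in> B))"
proof (intro iffI conjI)
  assume "limitin (topology_generated_by \<B>) f l F"
  then show "l \<in> \<Union>\<B>" "\<forall>B\<in>\<B>. l \<in> B \<longrightarrow> (\<forall>\<^sub>F x in F. f x \<in> B)"
    by (auto simp: limitin_def topology_generated_by_topspace intro: topology_generated_by_Basis)
next
  assume R: "l \<in> \<Union>\<B> \<and> (\<forall>B\<in>\<B>. l \<in> B \<longrightarrow> (\<forall>\<^sub>F x in F. f x \<in> B))"
  have "\<forall>\<^sub>F x in F. f x \<in> U" if "generate_topology_on \<B> U" "l \<in> U" for U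
    using that
  proof (induction rule: generate_topology_on.induct)
    case (UN K)
    then obtain k where "k \<in> K" "\<forall>\<^sub>F x in F. f x \<in> k"
      by blast
    then show ?case
      by (auto elim: eventually_mono)
  qed (use R in \<open>auto intro: eventually_conj\<close>)
  with R show "limitin (topology_generated_by \<B>) f l F"
    by (auto simp: limitin_def topology_generated_by_topspace openin_topology_generated_by_iff)
qed

lemma tail_in_state_set:
  assumes "expansion_system \<Psi>" and "y \<in> state_set \<Psi> 0"
  shows "tail \<Psi> y i \<in> state_set \<Psi> i"
  using assms by (induction i) (auto simp: expansion_system_def Pi_iff)

lemma P_hat_in_coeff_set:
  assumes "expansion_system \<Psi>" and "y \<in> state_set \<Psi> 0"
  shows "P_hat \<Psi> y i \<in> coeff_set \<Psi> i"
  using tail_in_state_set[OF assms] assms by (auto simp: expansion_system_def P_hat_def Pi_iff)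

text \<open>Properness puts the pair in the image of \<open>fmap_at \<Psi> i\<close>, so
  \<open>inv_into\<close> returns a genuine preimage.\<close>

lemma fmap_at_conv_tail:
  assumes "proper_at \<Psi> y n" and "i < n"
  shows "fmap_at \<Psi> i (conv_tail \<Psi> y n i) = (P_hat \<Psi> y i, conv_tail \<Psi> y n (Suc i))"
  using assms conv_tail.simps[of \<Psi> y n i] by (auto simp: proper_at_def f_inv_into_f)

text \<open>For \<open>n = 0\<close> the convergent is the neutral element; otherwise properness at
  index 0 makes it a preimage chosen in \<open>state_set \<Psi> 0\<close>.\<close>

lemma conv_in_state_set:
  assumes "expansion_system \<Psi>" and "proper_at \<Psi> y n"
  shows "conv \<Psi> y n \<in> state_set \<Psi> 0"
  using assms conv_tail.simps[of \<Psi> y n 0]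
  by (auto simp: conv_def proper_at_def expansion_system_def intro: inv_into_into)

text \<open>By the second component of \<open>fmap_at_conv_tail\<close>, each application of
  \<open>emap\<close> undoes one step of the backward recursion.\<close>

lemma tail_conv:
  assumes "proper_at \<Psi> y n" and "i \<le> n"
  shows "tail \<Psi> (conv \<Psi> y n) i = conv_tail \<Psi> y n i"
  using assms(2)
proof (induction i)
  case (Suc i)
  then show ?case
    using fmap_at_conv_tail[OF assms(1), of i] by (simp add: fmap_at_def)
qed (simp add: conv_def)

text \<open>This is the first component of \<open>fmap_at_conv_tail\<close>. The bound is strict: at
  \<open>i = n\<close> the tail is neutral, and its coefficient may differ from that of
  \<open>y\<close>.\<close>

lemma P_hat_conv:
  assumes "proper_at \<Psi> y n" and "i < n"
  shows "P_hat \<Psi> (conv \<Psi> y n) i = P_hat \<Psi> y i"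
  using fmap_at_conv_tail[OF assms] tail_conv[of \<Psi> y n i] assms
  by (simp add: fmap_at_def P_hat_def)

theorem theorem3p6:
  fixes \<Psi> :: "('s, 'c) expansion_data" and y :: 's
  assumes "expansion_system \<Psi>"
    and "y \<in> state_set \<Psi> 0"
    and "\<And>m. proper_at \<Psi> y m"
  shows "limitin (discrete_product \<Psi>) (\<lambda>m. P_hat \<Psi> (conv \<Psi> y m)) (P_hat \<Psi> y) sequentially
    \<and> limitin (weakly_discrete \<Psi>) (conv \<Psi> y) y sequentially"
proof
  have conv_in: "conv \<Psi> y m \<in> state_set \<Psi> 0" for m
    using assms(1,3) by (rule conv_in_state_set)
  have "\<forall>\<^sub>F m in sequentially. P_hat \<Psi> (conv \<Psi> y m) i = P_hat \<Psi> y i" for i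
    using eventually_gt_at_top[of i] by eventually_elim (rule P_hat_conv[OF assms(3)])
  then have "limitin (discrete_topology (coeff_set \<Psi> i)) (\<lambda>m. P_hat \<Psi> (conv \<Psi> y m) i)
      (P_hat \<Psi> y i) sequentially" for i
    using P_hat_in_coeff_set[OF assms(1,2)] by (intro limitin_eventually) auto
  then show lim: "limitin (discrete_product \<Psi>) (\<lambda>m. P_hat \<Psi> (conv \<Psi> y m)) (P_hat \<Psi> y) sequentially"
    \<comment> \<open>Componentwise convergence also asks that the sequence eventually lie in the
      product of the \<open>coeff_set \<Psi> i\<close>.\<close>
    using P_hat_in_coeff_set[OF assms(1) conv_in]
    by (auto simp: discrete_product_def limitin_componentwise PiE_UNIV_domain Pi_iff)
  \<comment> \<open>The generators are preimages of open sets \<open>U\<close>, so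
    \<open>lim\<close> applied to \<open>U\<close> gives the test for each one. The whole product
    space as \<open>U\<close> gives a generator containing \<open>y\<close>.\<close>
  show "limitin (weakly_discrete \<Psi>) (conv \<Psi> y) y sequentially"
    unfolding weakly_discrete_def limitin_topology_generated_by
  proof
    show "y \<in> \<Union>{P_hat \<Psi> -` U \<inter> state_set \<Psi> 0 |U. openin (discrete_product \<Psi>) U}"
      using lim assms(2) by (auto simp: limitin_def)
  qed (use lim conv_in in \<open>auto simp: limitin_def\<close>)
qed

end
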